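(* Let $\ell>0$ be a real number and let $m$ be a positive even integer. Let $\kappa(\boldsymbol r)=\exp\!\left(-\frac{\|\boldsymbol r\|_2^2}{2\ell^2}\right)$ for $\boldsymbol r\in[-1/2,1/2]^3$ be the trivariate Gaussian kernel, continued $1$-periodically in each coordinate, and let $\kappa_{\mathrm{ERR}}=\kappa-\kappa_{\mathrm F}$ be its Fourier approximation error, where $\kappa_{\mathrm F}$ is the trigonometric polynomial built from the discrete Fourier coefficients of $\kappa$ on the equispaced grid with $m^3$ points (see context). Put $\eta:=\frac{\ell\pi m}{\sqrt2}$ and assume $\eta\ge 1$. Then $$\|\kappa_{\mathrm{ERR}}\|_\infty\le 15\,\gamma(\eta,\ell)\left(\gamma(\eta,\ell)+\frac52\right)+102\,A(\eta,\ell),$$ where $$\gamma(\eta,\ell):=\ell\sqrt{2\pi}\,e^{-\eta^2}+\begin{cases}\dfrac{e^{-1/(8\ell^2)}}{\eta^2} & \text{if } \ell<\frac12,\\[2mm] \dfrac{2\ell e^{-1/2}}{\eta^2} & \text{if } \ell\ge\frac12,\end{cases}$$ and $$A(\eta,\ell):=\frac{1}{2\eta\sqrt\pi}\,e^{-\eta^2}+\begin{cases}\dfrac{e^{-1/(8\ell^2)}}{\sqrt2\,\ell\pi\eta} & \text{if } \ell<\frac12,\\[2mm] \dfrac{\sqrt2\,e^{-1/2}}{\pi\eta} & \text{if } \ell\ge\frac12.\end{cases}$$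
   Context: Let $m$ be a positive even integer and $\mathcal I_m:=\{\boldsymbol k\in\mathbb Z^3: -\frac m2\le k_j<\frac m2 \text{ for } j=1,2,3\}$. A kernel $\kappa:[-1/2,1/2]^3\to\mathbb R$ (even in each coordinate) is regarded as a function on the torus $\mathbb T^3$ by simple $1$-periodic continuation in each coordinate. Its discrete Fourier coefficients are $$\hat c_{\boldsymbol k}:=\frac1{m^3}\sum_{\boldsymbol j\in\mathcal I_m}\kappa\!\left(\frac{\boldsymbol j}{m}\right)e^{-2\pi \mathrm i\,\boldsymbol j^{\top}\boldsymbol k/m},\qquad \boldsymbol k\in\mathcal I_m,$$ the Fourier approximation of $\kappa$ is $$\kappa_{\mathrm F}(\boldsymbol r):=\sum_{\boldsymbol k\in\mathcal I_m}\hat c_{\boldsymbol k}\,e^{2\pi \mathrm i\,\boldsymbol k^{\top}\boldsymbol r},$$ and the approximation error is $\kappa_{\mathrm{ERR}}(\boldsymbol r):=\kappa(\boldsymbol r)-\kappa_{\mathrm F}(\boldsymbol r)$, with $$\|\kappa_{\mathrm{ERR}}\|_\infty:=\max_{\boldsymbol r\in[-1/2,1/2]^3}|\kappa_{\mathrm{ERR}}(\boldsymbol r)|.$$ *)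

theory Defs
  imports "HOL-Analysis.Analysis"
begin

definition cube :: "(real ^ 3) set" where
  "cube = {r. \<forall>i. - (1/2) \<le> r $ i \<and> r $ i \<le> 1/2}"

text \<open>
  Every coordinate is shifted by an integer into \<open>[-1/2, 1/2)\<close>, so only the values of
  \<open>\<kappa>\<close> on the cube matter.  If \<open>\<kappa>\<close> is even in each coordinate, the
  continuation agrees with \<open>\<kappa>\<close> on the faces \<open>r $ i = 1/2\<close> as well.
\<close>

definition periodic_cont :: "(real ^ 3 \<Rightarrow> real) \<Rightarrow> real ^ 3 \<Rightarrow> real" where
  "periodic_cont \<kappa> r = \<kappa> (\<chi> i. r $ i - of_int \<lfloor>r $ i + 1/2\<rfloor>)"

definition freq_set :: "nat \<Rightarrow> (int ^ 3) set" where
  "freq_set m = {k. \<forall>i. - (real m / 2) \<le> real_of_int (k $ i) \<and> real_of_int (k $ i) < real m / 2}"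

definition dft_coeff :: "(real ^ 3 \<Rightarrow> real) \<Rightarrow> nat \<Rightarrow> int ^ 3 \<Rightarrow> complex" where
  "dft_coeff \<kappa> m k =
     1 / of_nat m ^ 3 *
     (\<Sum>j\<in>freq_set m. complex_of_real (\<kappa> (\<chi> i. of_int (j $ i) / of_nat m)) *
        exp (- 2 * of_real pi * \<i> * of_int (\<Sum>i\<in>UNIV. j $ i * k $ i) / of_nat m))"

definition fourier_approx :: "(real ^ 3 \<Rightarrow> real) \<Rightarrow> nat \<Rightarrow> real ^ 3 \<Rightarrow> complex" where
  "fourier_approx \<kappa> m r =
     (\<Sum>k\<in>freq_set m. dft_coeff \<kappa> m k *
        exp (2 * of_real pi * \<i> * of_real (\<Sum>i\<in>UNIV. of_int (k $ i) * r $ i)))"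

definition fourier_error :: "(real ^ 3 \<Rightarrow> real) \<Rightarrow> nat \<Rightarrow> real ^ 3 \<Rightarrow> complex" where
  "fourier_error \<kappa> m r = complex_of_real (\<kappa> r) - fourier_approx \<kappa> m r"

text \<open>
  The norm is written as a supremum; by \<open>fourier_error_gauss_attains_max\<close> below it is an
  attained maximum for the error functions considered here.
\<close>

definition sup_norm_cube :: "(real ^ 3 \<Rightarrow> complex) \<Rightarrow> real" where
  "sup_norm_cube f = (SUP r\<in>cube. cmod (f r))"

definition gauss_kernel :: "real \<Rightarrow> real ^ 3 \<Rightarrow> real" where
  "gauss_kernel l r = exp (- ((norm r)\<^sup>2 / (2 * l\<^sup>2)))"

definition gauss_gamma :: "real \<Rightarrow> real \<Rightarrow> real" where
  "gauss_gamma \<eta> l =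
     l * sqrt (2 * pi) * exp (- (\<eta>\<^sup>2)) +
     (if l < 1/2 then exp (- (1 / (8 * l\<^sup>2))) / \<eta>\<^sup>2
      else 2 * l * exp (- (1/2)) / \<eta>\<^sup>2)"

definition gauss_A :: "real \<Rightarrow> real \<Rightarrow> real" where
  "gauss_A \<eta> l =
     1 / (2 * \<eta> * sqrt pi) * exp (- (\<eta>\<^sup>2)) +
     (if l < 1/2 then exp (- (1 / (8 * l\<^sup>2))) / (sqrt 2 * l * pi * \<eta>)
      else sqrt 2 * exp (- (1/2)) / (pi * \<eta>))"

lemma finite_freq_set: "finite (freq_set m)"
proof (rule finite_subset)
  let ?I = "{- int m..int m}"
  show "freq_set m \<subseteq> (\<lambda>(a, b, c). vector [a, b, c]) ` (?I \<times> ?I \<times> ?I)"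
  proof
    fix k assume "k \<in> freq_set m"
    hence "- (real m / 2) \<le> of_int (k $ i)" "of_int (k $ i) < real m / 2" for i
      by (auto simp: freq_set_def)
    hence "k $ i \<in> ?I" for i by (smt (verit) atLeastAtMost_iff field_sum_of_halves
        of_int_less_iff of_int_minus of_int_of_nat_eq of_nat_0_le_iff)
    moreover have "k = vector [k $ 1, k $ 2, k $ 3]"
      by (simp add: vec_eq_iff forall_3 vector_3)
    ultimately show "k \<in> (\<lambda>(a, b, c). vector [a, b, c]) ` (?I \<times> ?I \<times> ?I)"
      by (intro image_eqI[of _ _ "(k $ 1, k $ 2, k $ 3)"]) auto
  qed
qed simp

lemma cube_eq_cbox: "cube = cbox (\<chi> i. - (1/2)) (\<chi> i. 1/2)"
  by (auto simp: cube_def mem_box_cart)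

lemma periodic_cont_gauss_on_cube:
  assumes "r \<in> cube"
  shows "periodic_cont (gauss_kernel l) r = gauss_kernel l r"
proof -
  have "(r $ i - of_int \<lfloor>r $ i + 1/2\<rfloor>)\<^sup>2 = (r $ i)\<^sup>2" for i
  proof (cases "r $ i = 1/2")
    case False
    with assms have "- (1/2) \<le> r $ i" "r $ i < 1/2"
      by (auto simp: cube_def less_le)
    hence "\<lfloor>r $ i + 1/2\<rfloor> = 0" by (simp add: floor_eq_iff)
    thus ?thesis by simp
  next
    case True
    show ?thesis unfolding True by simp
  qed
  hence "(norm (\<chi> i. r $ i - of_int \<lfloor>r $ i + 1/2\<rfloor>))\<^sup>2 = (norm r)\<^sup>2"
    by (simp add: norm_vec_def L2_set_def sum_nonneg)
  thus ?thesis by (simp add: periodic_cont_def gauss_kernel_def)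
qed

lemma fourier_error_gauss_attains_max:
  "\<exists>r\<in>cube. cmod (fourier_error (periodic_cont (gauss_kernel l)) m r) =
              sup_norm_cube (fourier_error (periodic_cont (gauss_kernel l)) m)"
proof -
  let ?e = "\<lambda>r. cmod (fourier_error (periodic_cont (gauss_kernel l)) m r)"
  have "continuous_on cube (gauss_kernel l)"
    unfolding gauss_kernel_def divide_inverse by (intro continuous_intros)
  hence "continuous_on cube (periodic_cont (gauss_kernel l))"
    by (simp add: periodic_cont_gauss_on_cube cong: continuous_on_cong)
  moreover have "continuous_on cube (fourier_approx (periodic_cont (gauss_kernel l)) m)"
    unfolding fourier_approx_def by (intro continuous_intros)
  ultimately have "continuous_on cube ?e"
    unfolding fourier_error_def by (intro continuous_intros)
  moreover have "compact cube" by (simp add: cube_eq_cbox)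
  moreover have "0 \<in> cube" by (simp add: cube_def)
  ultimately obtain r where r: "r \<in> cube" "\<forall>s\<in>cube. ?e s \<le> ?e r"
    using continuous_attains_sup[of cube ?e] by blast
  hence "(SUP r\<in>cube. ?e r) = ?e r"
    by (intro cSup_eq_maximum) auto
  with r(1) show ?thesis unfolding sup_norm_cube_def by (intro bexI[of _ r]) auto
qed

end

theory Submission
  imports Defs "HOL-Probability.Characteristic_Functions"
begin

text \<open>
  The Gaussian and its discrete Fourier approximation are tensor products of their
  one-dimensional versions \<open>g\<close> and \<open>F\<close>, so \<open>\<bar>g - F\<bar> \<le> e\<close> and \<open>\<bar>g\<bar> \<le> 1\<close> give the
  three-dimensional error bound \<open>(1 + e)^3 - 1\<close>.  In one dimension, \<open>g\<close> is the sum of an absolutely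
  convergent cosine series on \<open>[-1/2, 1/2]\<close>.  With \<open>m = 2 M\<close>, interpolation reproduces the
  modes below \<open>M\<close> and aliases the others to lower modes, so that
  \<open>e \<le> 2 \<bar>c M\<bar> + 4 (\<Sum>k>M. \<bar>c k\<bar>)\<close> for the Fourier coefficients \<open>c k\<close> of \<open>g\<close>.
  Writing \<open>c k\<close> as the Gaussian integral over the real line minus the tails beyond \<open>1/2\<close>, and
  integrating the tails by parts twice, bounds \<open>\<bar>c M\<bar>\<close> by \<open>gauss_gamma\<close> and the sum by
  \<open>gauss_A\<close>.  Finally, \<open>\<eta> \<ge> 1\<close> forces \<open>gauss_gamma \<le> 9/10\<close> and \<open>gauss_A \<le> 2/5\<close>, and in this range
  the cubic in \<open>e\<close> stays below the claimed bound.
\<close>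

subsection \<open>Cosine series\<close>

text \<open>One factor \<open>cos (2 * pi * x)\<close> times a cosine of frequency \<open>k\<close>
  is the mean of the cosines of frequencies \<open>k + 1\<close> and \<open>k - 1\<close>. Hence the
  induction on \<open>n\<close> keeps \<open>k\<close> arbitrary; for \<open>k = 0\<close> the
  product is the cosine of frequency 1.\<close>

lemma cosine_power_integral_eq_0:
  fixes f :: "real \<Rightarrow> real"
  assumes f: "continuous_on {0..1/2} f"
    and zero: "\<And>k::nat. integral {0..1/2} (\<lambda>x. f x * cos (2 * pi * k * x)) = 0"
  shows "integral {0..1/2} (\<lambda>x. f x * (cos (2 * pi * x) ^ n * cos (2 * pi * real k * x))) = 0"
proof (induction n arbitrary: k)
  case 0
  then show ?case using zero by simp
next
  case (Suc n)
  let ?I = "\<lambda>k::nat. \<lambda>x. f x * (cos (2 * pi * x) ^ n * cos (2 * pi * k * x))"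
  have int: "?I k integrable_on {0..1/2}" for k
    by (intro integrable_continuous_interval continuous_intros f)
  show ?case
  proof (cases k)
    case 0
    then show ?thesis using Suc[of 1] by (simp add: mult_ac)
  next
    case (Suc j)
    have "f x * (cos (2 * pi * x) ^ Suc n * cos (2 * pi * k * x))
        = (?I (k + 1) x + ?I j x) * (1/2)" for x
    proof -
      have "cos (2 * pi * x) * cos (2 * pi * k * x) = (cos (2 * pi * (k+1) * x) + cos (2 * pi * j * x)) * (1/2)"
        by (subst mult.commute, subst cos_times_cos) (simp add: Suc algebra_simps)
      hence "f x * cos (2 * pi * x) ^ n * (cos (2 * pi * x) * cos (2 * pi * k * x))
           = f x * cos (2 * pi * x) ^ n * ((cos (2 * pi * (k+1) * x) + cos (2 * pi * j * x)) * (1/2))"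
        by (rule arg_cong)
      thus ?thesis by (simp only: power_Suc distrib_left distrib_right mult_ac)
    qed
    hence "integral {0..1/2} (\<lambda>x. f x * (cos (2 * pi * x) ^ Suc n * cos (2 * pi * k * x)))
       = integral {0..1/2} (\<lambda>x. (?I (k + 1) x + ?I j x) * (1/2))"
      by (intro integral_cong)
    also have "\<dots> = (integral {0..1/2} (?I (k + 1)) + integral {0..1/2} (?I j)) * (1/2)"
      by (subst integral_mult_left, subst integral_add[OF int int]) simp_all
    also have "\<dots> = 0" unfolding Suc.IH by simp
    finally show ?thesis .
  qed
qed

lemma cosine_coeffs_eq_0_imp_eq_0:
  fixes f :: "real \<Rightarrow> real"
  assumes f: "continuous_on {0..1/2} f"
    and zero: "\<And>k::nat. integral {0..1/2} (\<lambda>x. f x * cos (2 * pi * k * x)) = 0"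
    and x: "x \<in> {0..1/2}"
  shows "f x = 0"
proof -
  \<comment> \<open>\<open>f\<close> is a continuous function of \<open>cos (2 \<pi> x)\<close>, hence a uniform limit of polynomials in it,
    and \<open>f\<close> is orthogonal to all of these.\<close>
  define H where "H t = f (arccos t / (2 * pi))" for t
  define L where "L = integral {0..1/2} (\<lambda>x. \<bar>f x\<bar>)"
  have L0: "L \<ge> 0" unfolding L_def by (intro integral_nonneg integrable_continuous_interval continuous_intros f) auto
  have fsq: "(\<lambda>x. (f x)\<^sup>2) integrable_on {0..1/2}"
    by (intro integrable_continuous_interval continuous_intros f)
  have Hc: "continuous_on {-1..1} H"
    unfolding H_def
    by (intro continuous_on_compose2[OF f] continuous_intros) (auto simp: arccos_lbound arccos_ubound field_simps)
  have Hf: "H (cos (2 * pi * y)) = f y" if "y \<in> {0..1/2}" for y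
    using that by (simp add: H_def arccos_cos)
  have bound: "integral {0..1/2} (\<lambda>x. (f x)\<^sup>2) \<le> e * L" if "e > 0" for e
  proof -
    obtain p where p: "real_polynomial_function p" "\<And>t. t \<in> {-1..1} \<Longrightarrow> \<bar>H t - p t\<bar> < e"
      using Stone_Weierstrass_real_polynomial_function[OF _ Hc \<open>e > 0\<close>] by auto
    obtain a N where pa: "p = (\<lambda>t. \<Sum>i\<le>N. a i * t ^ i)"
      using p(1) real_polynomial_function_iff_sum by blast
    have pc: "continuous_on {0..1/2} (\<lambda>x. p (cos (2 * pi * x)))"
      unfolding pa by (intro continuous_intros)
    \<comment> \<open>The cosine of frequency 0 is the constant 1; it is inserted so that the
      vanishing of the integrals with cosine powers applies literally.\<close>
    have "integral {0..1/2} (\<lambda>x. f x * p (cos (2 * pi * x)))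
        = integral {0..1/2} (\<lambda>x. \<Sum>i\<le>N. a i * (f x * (cos (2 * pi * x) ^ i * cos (2 * pi * real 0 * x))))"
      by (simp add: pa sum_distrib_left mult_ac)
    also have "\<dots> = (\<Sum>i\<le>N. a i * integral {0..1/2} (\<lambda>x. f x * (cos (2 * pi * x) ^ i * cos (2 * pi * real 0 * x))))"
      by (subst integral_sum) (auto intro!: integrable_continuous_interval continuous_intros f simp del: of_nat_0)
    also have "\<dots> = 0"
      by (simp only: cosine_power_integral_eq_0[OF f zero] mult_zero_right sum.neutral_const)
    finally have z: "integral {0..1/2} (\<lambda>x. f x * p (cos (2 * pi * x))) = 0" .
    \<comment> \<open>Orthogonality allows one factor \<open>f\<close> to be replaced by the
      uniformly small \<open>f - p\<close>.\<close>
    have "integral {0..1/2} (\<lambda>x. (f x)\<^sup>2) = integral {0..1/2} (\<lambda>x. (f x)\<^sup>2) - integral {0..1/2} (\<lambda>x. f x * p (cos (2 * pi * x)))"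
      using z by simp
    also have "\<dots> = integral {0..1/2} (\<lambda>x. (f x)\<^sup>2 - f x * p (cos (2 * pi * x)))"
      by (intro integral_diff[symmetric] integrable_continuous_interval continuous_intros f pc)
    also have "\<dots> \<le> integral {0..1/2} (\<lambda>x. e * \<bar>f x\<bar>)"
    proof (intro integral_le integrable_continuous_interval continuous_intros f pc)
      fix y :: real assume y: "y \<in> {0..1/2}"
      have "(f y)\<^sup>2 - f y * p (cos (2 * pi * y)) = f y * (H (cos (2 * pi * y)) - p (cos (2 * pi * y)))"
        using Hf[OF y] by (simp add: power2_eq_square algebra_simps)
      also have "\<dots> \<le> \<bar>f y\<bar> * \<bar>H (cos (2 * pi * y)) - p (cos (2 * pi * y))\<bar>"
        by (metis abs_ge_self abs_mult)
      also have "\<dots> \<le> \<bar>f y\<bar> * e"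
        by (intro mult_left_mono less_imp_le[OF p(2)]) auto
      finally show "(f y)\<^sup>2 - f y * p (cos (2 * pi * y)) \<le> e * \<bar>f y\<bar>" by (simp add: mult.commute)
    qed
    also have "\<dots> = e * L" by (simp add: L_def)
    finally show ?thesis .
  qed
  have "integral {0..1/2} (\<lambda>x. (f x)\<^sup>2) \<le> 0"
  proof (rule field_le_epsilon)
    fix e :: real assume "e > 0"
    \<comment> \<open>Dividing by \<open>L + 1\<close> rather than \<open>L\<close> covers the case
      \<open>L = 0\<close>.\<close>
    have "integral {0..1/2} (\<lambda>x. (f x)\<^sup>2) \<le> (e / (L + 1)) * L"
      using L0 \<open>e > 0\<close> by (intro bound) (auto simp: field_simps)
    also have "\<dots> \<le> 0 + e" using L0 \<open>e > 0\<close> by (simp add: field_simps)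
    finally show "integral {0..1/2} (\<lambda>x. (f x)\<^sup>2) \<le> 0 + e" .
  qed
  moreover have "integral {0..1/2} (\<lambda>x. (f x)\<^sup>2) \<ge> 0" by (intro integral_nonneg fsq) auto
  ultimately have "integral {0..1/2} (\<lambda>x. (f x)\<^sup>2) = 0" by simp
  hence "(f x)\<^sup>2 = 0"
    using x by (subst (asm) integral_eq_0_iff) (auto intro: continuous_on_power f)
  thus ?thesis by simp
qed

text \<open>The frequency is an integer because the product-to-sum formula produces the difference
  \<open>j - k\<close> of two naturals.\<close>

lemma integral_cos_nat:
  "integral {0..1/2} (\<lambda>x. cos (2 * pi * of_int n * x)) = (if n = 0 then 1/2 else 0)"
proof (cases "n = 0")
  case False
  have "((\<lambda>x. cos (2 * pi * of_int n * x)) has_integral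
       sin (2 * pi * of_int n * (1/2)) / (2 * pi * of_int n) - sin (2 * pi * of_int n * 0) / (2 * pi * of_int n)) {0..1/2}"
    using False
    by (intro fundamental_theorem_of_calculus)
       (auto intro!: derivative_eq_intros simp flip: has_real_derivative_iff_has_vector_derivative)
  thus ?thesis using False by (simp add: integral_unique sin_integer_2pi mult.commute[of pi] sin_zero_iff_int2)
qed auto

lemma integral_cos_mult_cos:
  fixes j k :: nat
  shows "integral {0..1/2} (\<lambda>x. cos (2 * pi * j * x) * cos (2 * pi * k * x))
       = (if j = k then if k = 0 then 1/2 else 1/4 else 0)"
proof -
  let ?c = "\<lambda>n x. cos (2 * pi * of_int n * x)"
  have "cos (2 * pi * j * x) * cos (2 * pi * k * x) = (?c (int j - int k) x + ?c (int j + int k) x) * (1/2)" for x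
    by (simp add: cos_times_cos algebra_simps)
  then have "integral {0..1/2} (\<lambda>x. cos (2 * pi * j * x) * cos (2 * pi * k * x))
       = integral {0..1/2} (\<lambda>x. (?c (int j - int k) x + ?c (int j + int k) x) * (1/2))" by (intro integral_cong)
  also have "\<dots> = (integral {0..1/2} (?c (int j - int k)) + integral {0..1/2} (?c (int j + int k))) * (1/2)"
    by (subst integral_mult_left, subst integral_add)
       (auto intro!: integrable_continuous_interval continuous_intros)
  also have "\<dots> = (if j = k then if k = 0 then 1/2 else 1/4 else 0)"
    unfolding integral_cos_nat by auto
  finally show ?thesis .
qed

text \<open>Summable coefficients make the series converge uniformly to a continuous
  \<open>S\<close>. Integrating term by term shows that \<open>S\<close> and \<open>f\<close> have
  the same cosine coefficients, and a continuous function with vanishing cosine coefficients is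
  zero.\<close>

lemma cosine_series_sums:
  fixes f :: "real \<Rightarrow> real" and b :: "nat \<Rightarrow> real"
  assumes f: "continuous_on {0..1/2} f"
    and b: "\<And>k. b k = (if k = 0 then 2 else 4) * integral {0..1/2} (\<lambda>x. f x * cos (2 * pi * k * x))"
    and sb: "summable (\<lambda>k. \<bar>b k\<bar>)"
    and x: "x \<in> {0..1/2}"
  shows "(\<lambda>k. b k * cos (2 * pi * k * x)) sums f x"
proof -
  let ?t = "\<lambda>k::nat. \<lambda>x. b k * cos (2 * pi * k * x)"
  define S where "S x = (\<Sum>k. ?t k x)" for x
  have bd: "norm (?t k x) \<le> \<bar>b k\<bar>" for k x
    by (simp add: abs_mult mult_left_le)
  have lim: "uniform_limit {0..1/2} (\<lambda>N x. \<Sum>k<N. ?t k x) S sequentially"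
    unfolding S_def by (rule Weierstrass_m_test[OF _ sb]) (use bd in auto)
  have Sc: "continuous_on {0..1/2} S"
    by (rule uniform_limit_theorem[OF _ lim]) (auto intro!: always_eventually continuous_intros)
  have coeff: "integral {0..1/2} (\<lambda>x. S x * cos (2 * pi * j * x))
             = integral {0..1/2} (\<lambda>x. f x * cos (2 * pi * j * x))" for j :: nat
  proof -
    have "uniform_limit {0..1/2} (\<lambda>N x. (\<Sum>k<N. ?t k x) * cos (2 * pi * j * x))
            (\<lambda>x. S x * cos (2 * pi * j * x)) sequentially"
    proof (rule uniform_lim_mult[OF lim uniform_limit_const])
      show "bounded (S ` {0..1/2})"
        by (intro compact_imp_bounded compact_continuous_image Sc) simp
      show "bounded ((\<lambda>x. cos (2 * pi * j * x)) ` {0..1/2})"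
        by (intro compact_imp_bounded compact_continuous_image continuous_intros) simp
    qed
    then obtain I J where IJ:
        "\<And>N. ((\<lambda>x. (\<Sum>k<N. ?t k x) * cos (2 * pi * j * x)) has_integral I N) {0..1/2}"
        "((\<lambda>x. S x * cos (2 * pi * j * x)) has_integral J) {0..1/2}" "I \<longlonglongrightarrow> J"
      by (rule uniform_limit_integral) (auto intro!: continuous_intros)
    have "(\<lambda>N. integral {0..1/2} (\<lambda>x. (\<Sum>k<N. ?t k x) * cos (2 * pi * j * x)))
            \<longlonglongrightarrow> integral {0..1/2} (\<lambda>x. S x * cos (2 * pi * j * x))" 
      (is "?L \<longlonglongrightarrow> _")
      using IJ(3) unfolding IJ(1,2)[THEN integral_unique] .
    moreover have "eventually (\<lambda>N. ?L N = integral {0..1/2} (\<lambda>x. f x * cos (2 * pi * j * x))) sequentially"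
      using eventually_gt_at_top[of j]
    proof eventually_elim
      case (elim N)
      have "?L N = integral {0..1/2} (\<lambda>x. \<Sum>k<N. b k * (cos (2 * pi * k * x) * cos (2 * pi * j * x)))"
        by (simp add: sum_distrib_right mult.assoc)
      also have "\<dots> = (\<Sum>k<N. b k * integral {0..1/2} (\<lambda>x. cos (2 * pi * k * x) * cos (2 * pi * j * x)))"
        by (subst integral_sum) (auto intro!: integrable_continuous_interval continuous_intros)
      \<comment> \<open>By orthogonality only the mode \<open>j\<close> survives; the factors 1/2
        and 1/4 cancel the normalisation 2 and 4 of \<open>b\<close>.\<close>
      also have "\<dots> = (\<Sum>k<N. if k = j then b j * (if j = 0 then 1/2 else 1/4) else 0)"
        unfolding integral_cos_mult_cos by (intro sum.cong) auto
      also have "\<dots> = b j * (if j = 0 then 1/2 else 1/4)"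
        using elim by simp
      finally show ?case by (simp add: b)
    qed
    ultimately show ?thesis
      by (rule LIMSEQ_unique[OF _ tendsto_eventually])
  qed
  have "f x - S x = 0"
  proof (rule cosine_coeffs_eq_0_imp_eq_0[OF _ _ x])
    fix k :: nat
    have "integral {0..1/2} (\<lambda>x. f x * cos (2 * pi * k * x) - S x * cos (2 * pi * k * x)) =
          integral {0..1/2} (\<lambda>x. f x * cos (2 * pi * k * x)) - integral {0..1/2} (\<lambda>x. S x * cos (2 * pi * k * x))"
      by (intro integral_diff integrable_continuous_interval continuous_intros f Sc)
    thus "integral {0..1/2} (\<lambda>x. (f x - S x) * cos (2 * pi * k * x)) = 0"
      by (simp only: left_diff_distrib coeff diff_self)
  qed (intro continuous_intros f Sc)
  moreover have "summable (\<lambda>k. ?t k x)"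
    by (rule summable_comparison_test'[OF sb]) (rule bd)
  ultimately show ?thesis by (simp add: S_def summable_sums)
qed

subsection \<open>Trigonometric interpolation and aliasing\<close>

text \<open>The one-dimensional Fourier approximation with \<open>m = 2 * M\<close>: the inner
  quotient is the discrete Fourier coefficient. The argument is complex-valued so that single
  exponentials can be inserted.\<close>

definition trig_interp :: "nat \<Rightarrow> (real \<Rightarrow> complex) \<Rightarrow> real \<Rightarrow> complex" where
  "trig_interp M f x = (\<Sum>k\<in>{- int M..<int M}.
     (\<Sum>j\<in>{- int M..<int M}. f (j / real (2 * M)) * cis (- 2 * pi * j * k / real (2 * M))) / of_nat (2 * M) * cis (2 * pi * k * x))"

lemma trig_interp_sum:
  "trig_interp M (\<lambda>x. \<Sum>i\<in>I. b i * f i x) x = (\<Sum>i\<in>I. b i * trig_interp M (f i) x)"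
proof -
  let ?J = "{- int M..<int M}"
  have "trig_interp M (\<lambda>x. \<Sum>i\<in>I. b i * f i x) x =
    (\<Sum>k\<in>?J. \<Sum>i\<in>I. b i * ((\<Sum>j\<in>?J. f i (j / real (2 * M)) * cis (- 2 * pi * j * k / real (2 * M))) / of_nat (2 * M) * cis (2 * pi * k * x)))"
    unfolding trig_interp_def
    by (simp only: sum_distrib_right sum_distrib_left sum_divide_distrib sum.swap[of _ I] mult_ac times_divide_eq_right times_divide_eq_left)
  also have "\<dots> = (\<Sum>i\<in>I. b i * trig_interp M (f i) x)"
    unfolding trig_interp_def sum_distrib_left by (rule sum.swap)
  finally show ?thesis .
qed

text \<open>The interpolant depends on finitely many samples, all at nodes in [-1/2, 1/2], so
  pointwise convergence there suffices.\<close>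

lemma tendsto_trig_interp:
  assumes "\<And>t. \<bar>t\<bar> \<le> 1/2 \<Longrightarrow> ((\<lambda>n. f n t) \<longlongrightarrow> g t) F" and "M > 0"
  shows "((\<lambda>n. trig_interp M (f n) x) \<longlongrightarrow> trig_interp M g x) F"
  unfolding trig_interp_def
proof (intro tendsto_sum tendsto_mult tendsto_divide tendsto_const assms(1))
  fix j assume "j \<in> {- int M..<int M}"
  hence "\<bar>real_of_int j\<bar> \<le> real M" by auto
  thus "\<bar>real_of_int j / real (2 * M)\<bar> \<le> 1/2" using \<open>M > 0\<close> by (simp add: field_simps)
qed (use \<open>M > 0\<close> in auto)

text \<open>Shifting the index by \<open>M\<close> gives a geometric series in a root of unity
  \<open>z\<close> with \<open>z ^ (2 * M) = 1\<close>; it vanishes unless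
  \<open>z = 1\<close>.\<close>

lemma sum_roots_of_unity_int:
  assumes "M > 0"
  shows "(\<Sum>j\<in>{- int M..<int M}. cis (2 * pi * of_int j * of_int t / real (2 * M)))
       = (if int (2 * M) dvd t then of_nat (2 * M) else 0)"
proof -
  define z where "z = cis (2 * pi * t / real (2 * M))"
  have summand: "cis (2 * pi * of_int (int i - int M) * of_int t / real (2 * M)) = cis (- (pi * t)) * z ^ i" for i
  proof -
    have "2 * pi * of_int (int i - int M) * of_int t / real (2 * M) = - (pi * t) + real i * (2 * pi * t / real (2 * M))"
      using assms by (simp add: field_simps)
    thus ?thesis by (simp only: z_def Complex.DeMoivre cis_mult)
  qed
  have "(\<Sum>j\<in>{- int M..<int M}. cis (2 * pi * of_int j * of_int t / real (2 * M)))
      = (\<Sum>i<2*M. cis (2 * pi * of_int (int i - int M) * of_int t / real (2 * M)))"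
    by (rule sum.reindex_bij_witness[of _ "\<lambda>i. int i - int M" "\<lambda>j. nat (j + int M)"]) auto
  also have "\<dots> = cis (- (pi * t)) * (\<Sum>i<2*M. z ^ i)"
    by (simp only: summand sum_distrib_left)
  also have "\<dots> = (if int (2 * M) dvd t then of_nat (2 * M) else 0)"
  proof (cases "int (2 * M) dvd t")
    case True
    then obtain s where s: "t = int (2 * M) * s" by auto
    have "z = cis (2 * pi * of_int s)" "cis (- (pi * t)) = cis (2 * pi * of_int (- (int M * s)))"
      using assms by (simp_all add: z_def s mult_ac)
    hence "z = 1" "cis (- (pi * t)) = 1"
      by (simp_all only: cis_multiple_2pi Ints_of_int)
    thus ?thesis using True by simp
  next
    case False
    have "z ^ (2 * M) = cis (real (2 * M) * (2 * pi * t / real (2 * M)))"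
      by (simp only: z_def Complex.DeMoivre)
    also have "\<dots> = cis (2 * pi * of_int t)" using assms by (intro arg_cong[of _ _ cis]) simp
    also have "\<dots> = 1" by (rule cis_multiple_2pi) simp
    finally have zM: "z ^ (2 * M) = 1" .
    have "z \<noteq> 1"
    proof
      assume "z = 1"
      then obtain s :: int where "2 * pi * t / real (2 * M) = 2 * pi * s"
        unfolding z_def by (auto simp: cis_conv_exp exp_eq_1)
      hence "of_int t = real_of_int (int (2 * M) * s)" using assms by (simp add: field_simps)
      hence "t = int (2 * M) * s" by (simp only: of_int_eq_iff)
      thus False using False by simp
    qed
    thus ?thesis using False zM by (simp add: sum_gp_strict)
  qed
  finally show ?thesis .
qed

text \<open>Aliasing: frequencies congruent modulo \<open>2 * M\<close> have the same samples up to
  the orthogonality of the discrete exponentials, so the interpolant is the exponential of the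
  representative in the window.\<close>

lemma trig_interp_cis:
  assumes "M > 0"
  obtains k where "k \<in> {- int M..<int M}" "int (2 * M) dvd n - k"
    "trig_interp M (\<lambda>x. cis (2 * pi * of_int n * x)) = (\<lambda>x. cis (2 * pi * of_int k * x))"
proof
  \<comment> \<open>The shift by \<open>M\<close> moves the residue from \<open>{0..<2 * M}\<close>
    to the symmetric window.\<close>
  define k0 where "k0 = (n + int M) mod int (2 * M) - int M"
  let ?J = "{- int M..<int M}"
  have M: "int (2 * M) > 0" using assms by simp
  show k0: "k0 \<in> ?J" unfolding k0_def
    using pos_mod_bound[OF M, of "n + int M"] pos_mod_sign[OF M, of "n + int M"] by auto
  have "n - k0 = (n + int M) - (n + int M) mod int (2 * M)"
    by (simp add: k0_def)
  thus dvd: "int (2 * M) dvd n - k0" by (simp only: dvd_minus_mod)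
  have uniq: "int (2 * M) dvd n - k \<longleftrightarrow> k = k0" if "k \<in> ?J" for k
  proof
    assume "int (2 * M) dvd n - k"
    from dvd_diff[OF dvd this] have "int (2 * M) dvd k - k0" by simp
    moreover have "\<bar>k - k0\<bar> < \<bar>int (2 * M)\<bar>" using that k0 by auto
    ultimately show "k = k0" using dvd_imp_le_int[of "k - k0" "int (2 * M)"] by linarith
  qed (use dvd in auto)
  show "trig_interp M (\<lambda>x. cis (2 * pi * of_int n * x)) = (\<lambda>x. cis (2 * pi * of_int k0 * x))"
  proof
    fix x
    have "(\<Sum>j\<in>?J. cis (2 * pi * n * (j / real (2 * M))) * cis (- 2 * pi * j * k / real (2 * M)))
        = (if k = k0 then of_nat (2 * M) else 0)" if "k \<in> ?J" for k
    proof -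
      have "cis (2 * pi * n * (j / real (2 * M))) * cis (- 2 * pi * j * k / real (2 * M))
          = cis (2 * pi * of_int j * of_int (n - k) / real (2 * M))" for j :: int
        unfolding cis_mult using assms by (intro arg_cong[of _ _ cis]) (simp add: field_simps)
      thus ?thesis by (simp only: sum_roots_of_unity_int[OF assms] uniq[OF that])
    qed
    hence "trig_interp M (\<lambda>x. cis (2 * pi * of_int n * x)) x
      = (\<Sum>k\<in>?J. (if k = k0 then of_nat (2 * M) else 0) / of_nat (2 * M) * cis (2 * pi * k * x))"
      unfolding trig_interp_def by (intro sum.cong) simp_all
    also have "\<dots> = (\<Sum>k\<in>?J. if k = k0 then cis (2 * pi * k0 * x) else 0)"
      using assms by (intro sum.cong) auto
    also have "\<dots> = cis (2 * pi * k0 * x)" using k0 by simp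
    finally show "trig_interp M (\<lambda>x. cis (2 * pi * of_int n * x)) x = cis (2 * pi * k0 * x)" .
  qed
qed

lemma trig_interp_cis_same:
  assumes "n \<in> {- int M..<int M}"
  shows "trig_interp M (\<lambda>x. cis (2 * pi * of_int n * x)) = (\<lambda>x. cis (2 * pi * of_int n * x))"
proof -
  have "M > 0" using assms by auto
  then obtain k where k: "k \<in> {- int M..<int M}" "int (2 * M) dvd n - k"
    "trig_interp M (\<lambda>x. cis (2 * pi * of_int n * x)) = (\<lambda>x. cis (2 * pi * of_int k * x))"
    by (rule trig_interp_cis)
  have "\<bar>n - k\<bar> < \<bar>int (2 * M)\<bar>" using assms k(1) by auto
  hence "n = k" using k(2) dvd_imp_le_int[of "n - k" "int (2 * M)"] by linarith
  thus ?thesis using k(3) by simp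
qed

text \<open>
  The case \<open>n = M\<close> is special because \<open>- M\<close> is a frequency of the interpolant but \<open>M\<close> is not:
  only one of the two exponentials in the cosine is aliased.
\<close>

lemma trig_interp_cos_error:
  fixes n :: nat
  assumes "M > 0"
  shows "cmod (cos (2 * pi * n * x) - trig_interp M (\<lambda>x. cos (2 * pi * n * x)) x)
       \<le> (if n < M then 0 else if n = M then 1 else 2)"
proof -
  let ?e = "\<lambda>n::int. \<lambda>x. cis (2 * pi * of_int n * x)"
  define d where "d n = ?e n x - trig_interp M (?e n) x" for n
  \<comment> \<open>For \<open>n = 0\<close> the index set collapses to a single element, hence the
    weight 1.\<close>
  have cos: "complex_of_real (cos (2 * pi * n * x)) = (\<Sum>i\<in>{int n, - int n}. (if n = 0 then 1 else 1/2) * ?e i x)" for x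
    by (auto simp: complex_eq_iff)
  have "cos (2 * pi * n * x) - trig_interp M (\<lambda>x. cos (2 * pi * n * x)) x
      = (\<Sum>i\<in>{int n, - int n}. (if n = 0 then 1 else 1/2) * d i)"
    unfolding cos trig_interp_sum d_def right_diff_distrib sum_subtractf by (rule refl)
  also have "\<dots> = (d (int n) + d (- int n)) / 2"
    by auto
  finally have *: "cmod (cos (2 * pi * n * x) - trig_interp M (\<lambda>x. cos (2 * pi * n * x)) x)
    \<le> (cmod (d (int n)) + cmod (d (- int n))) / 2"
    by (metis norm_divide norm_numeral norm_triangle_ineq divide_right_mono zero_le_numeral)
  have d2: "cmod (d i) \<le> 2" for i
  proof -
    obtain k where "trig_interp M (?e i) = ?e k" using trig_interp_cis[OF assms] by metis
    hence "cmod (d i) \<le> cmod (?e i x) + cmod (?e k x)"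
      unfolding d_def by (metis norm_triangle_ineq4)
    thus ?thesis by simp
  qed
  have d0: "d i = 0" if "i \<in> {- int M..<int M}" for i
    unfolding d_def trig_interp_cis_same[OF that] by simp
  show ?thesis
    using assms * d2[of "int n"] d2[of "- int n"] d0[of "int n"] d0[of "- int n"] by (auto split: if_splits)
qed

text \<open>The mode errors 0, 1 and 2 are summed for partial sums of the series, and then
  \<open>N\<close> tends to infinity. Stating the hypothesis on \<open>B\<close> for finite sums
  avoids infinite tails.\<close>

lemma trig_interp_error_le:
  fixes f :: "real \<Rightarrow> real"
  assumes sums: "\<And>t. \<bar>t\<bar> \<le> 1/2 \<Longrightarrow> (\<lambda>k. b k * cos (2 * pi * real k * t)) sums f t"
    and M: "M > 0"
    and B: "\<And>N. N \<ge> M \<Longrightarrow> \<bar>b M\<bar> + 2 * (\<Sum>k\<in>{M<..N}. \<bar>b k\<bar>) \<le> B"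
    and x: "\<bar>x\<bar> \<le> 1/2"
  shows "cmod (f x - trig_interp M (\<lambda>t. f t) x) \<le> B"
proof -
  define S where "S N t = (\<Sum>k\<le>N. complex_of_real (b k) * cos (2 * pi * real k * t))" for N t
  have S: "(\<lambda>N. S N t) \<longlonglongrightarrow> f t" if "\<bar>t\<bar> \<le> 1/2" for t
    using tendsto_of_real[OF sums[OF that, unfolded sums_def_le]] by (simp add: S_def)
  have lim: "(\<lambda>N. cmod (S N x - trig_interp M (S N) x)) \<longlonglongrightarrow> cmod (f x - trig_interp M (\<lambda>t. f t) x)"
    by (intro tendsto_norm tendsto_diff S x tendsto_trig_interp M)
  have "cmod (S N x - trig_interp M (S N) x) \<le> B" if "N \<ge> M" for N
  proof -
    have "S N x - trig_interp M (S N) x = (\<Sum>k\<le>N. b k * (cos (2 * pi * k * x) - trig_interp M (\<lambda>x. cos (2 * pi * k * x)) x))"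
      unfolding S_def trig_interp_sum by (simp add: right_diff_distrib sum_subtractf)
    also have "cmod \<dots> \<le> (\<Sum>k\<le>N. \<bar>b k\<bar> * (if k < M then 0 else if k = M then 1 else 2))"
      by (intro sum_norm_le) (simp only: norm_mult norm_of_real mult_left_mono[OF trig_interp_cos_error[OF M]] abs_ge_zero)
    also have "\<dots> = (\<Sum>k\<in>{M..N}. \<bar>b k\<bar> * (if k < M then 0 else if k = M then 1 else 2))"
      by (intro sum.mono_neutral_right) auto
    also have "{M..N} = insert M {M<..N}" using that by auto
    also have "(\<Sum>k\<in>insert M {M<..N}. \<bar>b k\<bar> * (if k < M then 0 else if k = M then 1 else 2))
             = \<bar>b M\<bar> + 2 * (\<Sum>k\<in>{M<..N}. \<bar>b k\<bar>)"
      by (simp add: sum_distrib_left mult.commute)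
    also have "\<dots> \<le> B" using B[OF that] .
    finally show ?thesis .
  qed
  thus ?thesis
    by (intro tendsto_upperbound[OF lim] eventually_mono[OF eventually_ge_at_top[of M]]) auto
qed

subsection \<open>Fourier coefficients of the truncated Gaussian\<close>

text \<open>After rescaling by \<open>l\<close>, this is the real part of the characteristic
  function of the standard normal distribution at \<open>l * w\<close>.\<close>

lemma integral_gauss_times_cos:
  fixes l w :: real
  assumes l: "l > 0"
  shows "integrable lborel (\<lambda>x. exp (- (x\<^sup>2 / (2 * l\<^sup>2))) * cos (w * x))" (is "integrable _ ?f")
    and "(LINT x|lborel. exp (- (x\<^sup>2 / (2 * l\<^sup>2))) * cos (w * x))
           = l * sqrt (2 * pi) * exp (- ((l * w)\<^sup>2 / 2))"
proof -
  have "integrable lborel (\<lambda>x. sqrt (2 * pi * l\<^sup>2) * normal_density 0 l x)"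
    using l by (intro integrable_mult_right integrable_normal_density)
  thus "integrable lborel ?f"
  proof (rule Bochner_Integration.integrable_bound)
    show "AE x in lborel. norm (?f x) \<le> norm (sqrt (2 * pi * l\<^sup>2) * normal_density 0 l x)"
      using l by (auto simp: normal_density_def abs_mult intro!: mult_left_le)
  qed measurable
  have "exp (- ((l * w)\<^sup>2 / 2)) = Re (char std_normal_distribution (l * w))"
    by (simp add: char_std_normal_distribution)
  also have "\<dots> = (LINT x|std_normal_distribution. Re (iexp (l * w * x)))"
    unfolding char_def
    by (intro integral_Re[symmetric] prob_space.integrable_iexp)
       (simp_all add: real_distribution.axioms prob_space_normal_density)
  also have "\<dots> = (LINT x|lborel. std_normal_density x * cos (l * w * x))"
    by (subst integral_density) (simp_all add: Re_exp)
  also have "\<dots> = \<bar>1/l\<bar> *\<^sub>R (LINT x|lborel. std_normal_density (0 + 1/l * x) * cos (l * w * (0 + 1/l * x)))"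
    using l by (intro lborel_integral_real_affine) auto
  also have "\<dots> = (1/l) * (LINT x|lborel. (1 / sqrt (2 * pi)) * ?f x)"
    using l by (simp add: std_normal_density_def power_divide mult_ac)
  also have "\<dots> = (LINT x|lborel. ?f x) / (l * sqrt (2 * pi))"
    by (subst integral_mult_right_zero) simp
  finally show "(LINT x|lborel. ?f x) = l * sqrt (2 * pi) * exp (- ((l * w)\<^sup>2 / 2))"
    using l by (simp add: field_simps)
qed

text \<open>Dominated convergence over growing symmetric intervals, folded in half because the
  integrand is even. The offset \<open>a\<close> is free so that the upper end can later run through
  half-integers.\<close>

lemma gauss_half_line_limit:
  fixes l w a :: real
  assumes l: "l > 0"
  shows "(\<lambda>n. 2 * integral {0..real n + a} (\<lambda>x. exp (- (x\<^sup>2 / (2 * l\<^sup>2))) * cos (w * x)))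
           \<longlonglongrightarrow> l * sqrt (2 * pi) * exp (- ((l * w)\<^sup>2 / 2))"
proof -
  let ?f = "\<lambda>x. exp (- (x\<^sup>2 / (2 * l\<^sup>2))) * cos (w * x)"
  have cont: "continuous_on A ?f" for A
    using l by (intro continuous_intros) auto
  have "(\<lambda>n. LINT x|lborel. indicator {- (real n + a)..real n + a} x *\<^sub>R ?f x) \<longlonglongrightarrow> (LINT x|lborel. ?f x)"
  proof (rule integral_dominated_convergence[where w = "\<lambda>x. norm (?f x)"])
    show "AE x in lborel. (\<lambda>n. indicator {- (real n + a)..real n + a} x *\<^sub>R ?f x) \<longlonglongrightarrow> ?f x"
    proof (intro AE_I2 tendsto_eventually)
      fix x :: real
      show "\<forall>\<^sub>F n in sequentially. indicator {- (real n + a)..real n + a} x *\<^sub>R ?f x = ?f x"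
        using eventually_ge_at_top[of "nat \<lceil>\<bar>x\<bar> + \<bar>a\<bar>\<rceil>"]
      proof eventually_elim
        case (elim n)
        hence "\<bar>x\<bar> + \<bar>a\<bar> \<le> real n" by linarith
        thus ?case by (auto simp: indicator_def)
      qed
    qed
    show "integrable lborel (\<lambda>x. norm (?f x))"
      by (intro integrable_norm integral_gauss_times_cos l)
  qed (auto split: split_indicator)
  moreover have "\<forall>\<^sub>F n in sequentially. (LINT x|lborel. indicator {- (real n + a)..real n + a} x *\<^sub>R ?f x)
       = 2 * integral {0..real n + a} ?f"
    using eventually_ge_at_top[of "nat \<lceil>\<bar>a\<bar>\<rceil>"]
  proof eventually_elim
    case (elim n)
    define R where "R = real n + a"
    have R: "R \<ge> 0" using elim unfolding R_def by linarith
    have "(LINT x:{-R..R}|lborel. ?f x) = integral {-R..R} ?f"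
      by (intro set_borel_integral_eq_integral(2) borel_integrable_atLeastAtMost') (rule cont)
    also have "\<dots> = integral {-R..0} ?f + integral {0..R} ?f"
      using R by (intro Henstock_Kurzweil_Integration.integral_combine[symmetric] integrable_continuous_interval cont) auto
    also have "integral {-R..0} ?f = integral {0..R} ?f"
      using Henstock_Kurzweil_Integration.integral_reflect_real[of R 0 ?f] by simp
    finally show ?case by (simp add: set_lebesgue_integral_def R_def)
  qed
  ultimately show ?thesis
    using integral_gauss_times_cos(2)[OF l] by (simp add: tendsto_cong)
qed

text \<open>
  The upper end \<open>n + 1/2\<close> makes both sine boundary terms of the first integration by parts vanish.
  In the second one, \<open>x / l\<^sup>2 * exp (- x\<^sup>2 / (2 * l\<^sup>2))\<close> is integrated against a
  sine; it increases up to \<open>l\<close> and decreases afterwards, which accounts for the role of \<open>s\<close>.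
\<close>

lemma gauss_tail_cos_integral_le:
  fixes l :: real and k n :: nat
  defines "s \<equiv> max l (1/2)"
  assumes l: "l > 0" and k: "k > 0" and n: "real n + 1/2 \<ge> s"
  shows "\<bar>integral {1/2..real n + 1/2} (\<lambda>x. exp (- (x\<^sup>2 / (2 * l\<^sup>2))) * cos (2 * pi * k * x))\<bar>
           \<le> s / l\<^sup>2 * exp (- (s\<^sup>2 / (2 * l\<^sup>2))) / (2 * pi\<^sup>2 * (real k)\<^sup>2)"
proof -
  define g where "g x = exp (- (x\<^sup>2 / (2 * l\<^sup>2)))" for x
  define p where "p x = x / l\<^sup>2 * g x" for x
  define p' where "p' x = (1 - x\<^sup>2 / l\<^sup>2) / l\<^sup>2 * g x" for x
  define w where "w = 2 * pi * k"
  define R where "R = real n + 1/2"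
  have w: "w > 0" using k by (simp add: w_def)
  have sR: "1/2 \<le> s" "s \<le> R" using n by (auto simp: s_def R_def)
  have dg [derivative_intros]: "(g has_real_derivative - p x) (at x within A)" for x A
    unfolding g_def p_def using l by (auto intro!: derivative_eq_intros simp: field_simps power2_eq_square)
  have dp [derivative_intros]: "(p has_real_derivative p' x) (at x within A)" for x A
  proof -
    have "((\<lambda>x. x / l\<^sup>2) has_real_derivative 1 / l\<^sup>2) (at x within A)"
      by (rule DERIV_cdivide) (rule DERIV_ident)
    from DERIV_mult[OF this dg] show ?thesis
      unfolding p_def p'_def using l by (simp add: field_simps power2_eq_square)
  qed
  have p'c: "continuous_on A p'" for A
    unfolding p'_def g_def using l by (intro continuous_intros) auto
  \<comment> \<open>\<open>\<Phi>\<close> collects the boundary terms of both integrations by parts;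
    its derivative is the integrand minus the remaining
    \<open>p' x * cos (w * x) / w\<^sup>2\<close>.\<close>
  define \<Phi> where "\<Phi> x = g x * sin (w * x) / w - p x * cos (w * x) / w\<^sup>2" for x
  have d\<Phi>: "(\<Phi> has_real_derivative g x * cos (w * x) - p' x * cos (w * x) / w\<^sup>2) (at x within A)" for x A
    unfolding \<Phi>_def 
    by (rule derivative_eq_intros refl | use w in force)+ (use w in \<open>simp add: field_simps power2_eq_square\<close>)
  have "((\<lambda>x. g x * cos (w * x) - p' x * cos (w * x) / w\<^sup>2) has_integral \<Phi> R - \<Phi> (1/2)) {1/2..R}"
    using sR by (intro fundamental_theorem_of_calculus)
      (auto intro: d\<Phi> simp flip: has_real_derivative_iff_has_vector_derivative)
  moreover have "((\<lambda>x. p' x * cos (w * x) / w\<^sup>2) has_integral integral {1/2..R} (\<lambda>x. p' x * cos (w * x) / w\<^sup>2)) {1/2..R}"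
    using w by (intro integrable_integral integrable_continuous_interval continuous_intros p'c) auto
  ultimately have "((\<lambda>x. g x * cos (w * x) - p' x * cos (w * x) / w\<^sup>2 + p' x * cos (w * x) / w\<^sup>2) has_integral 
      \<Phi> R - \<Phi> (1/2) + integral {1/2..R} (\<lambda>x. p' x * cos (w * x) / w\<^sup>2)) {1/2..R}"
    by (rule has_integral_add)
  hence 1: "integral {1/2..R} (\<lambda>x. g x * cos (w * x)) = \<Phi> R - \<Phi> (1/2) + integral {1/2..R} (\<lambda>x. p' x * cos (w * x) / w\<^sup>2)"
    by (simp add: integral_unique)
  \<comment> \<open>The total variation of \<open>p\<close> is computed on both sides of its peak
    \<open>s\<close>. If \<open>l \<le> 1/2\<close>, then \<open>s = 1/2\<close> and this first
    interval is a point.\<close>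
  have "((\<lambda>x. \<bar>p' x\<bar>) has_integral (p s - p (1/2))) {1/2..s}"
  proof (cases "l \<le> 1/2")
    case False
    show ?thesis
    proof (rule has_integral_eq)
      show "(p' has_integral (p s - p (1/2))) {1/2..s}"
        using sR by (intro fundamental_theorem_of_calculus)
          (auto intro: dp simp flip: has_real_derivative_iff_has_vector_derivative)
      fix x assume x: "x \<in> {1/2..s}"
      hence "x\<^sup>2 \<le> l\<^sup>2" using False by (intro power_mono) (auto simp: s_def)
      hence "p' x \<ge> 0" using l by (simp add: p'_def g_def)
      thus "p' x = \<bar>p' x\<bar>" by simp
    qed
  qed (use has_integral_refl(2)[of "\<lambda>x. \<bar>p' x\<bar>" "1/2"] in \<open>simp add: s_def max_def\<close>)
  moreover have "((\<lambda>x. \<bar>p' x\<bar>) has_integral (p s - p R)) {s..R}"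
  proof (rule has_integral_eq)
    have "(p' has_integral (p R - p s)) {s..R}"
      using sR by (intro fundamental_theorem_of_calculus)
        (auto intro: dp simp flip: has_real_derivative_iff_has_vector_derivative)
    from has_integral_neg[OF this] show "((\<lambda>x. - p' x) has_integral (p s - p R)) {s..R}" by simp
    fix x assume x: "x \<in> {s..R}"
    hence "l\<^sup>2 \<le> x\<^sup>2" using l by (intro power_mono) (auto simp: s_def)
    hence "p' x \<le> 0" using l by (simp add: p'_def g_def mult_le_0_iff divide_le_0_iff)
    thus "- p' x = \<bar>p' x\<bar>" by simp
  qed
  ultimately have var: "((\<lambda>x. \<bar>p' x\<bar>) has_integral (p s - p (1/2)) + (p s - p R)) {1/2..R}"
    by (rule has_integral_combine[OF sR])
  have "norm (integral {1/2..R} (\<lambda>x. p' x * cos (w * x) / w\<^sup>2)) \<le> integral {1/2..R} (\<lambda>x. \<bar>p' x\<bar> / w\<^sup>2)"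
    using w by (intro integral_norm_bound_integral integrable_continuous_interval continuous_intros p'c)
      (auto simp: abs_mult intro!: divide_right_mono mult_left_le)
  also have "\<dots> = (2 * p s - p (1/2) - p R) / w\<^sup>2"
    using var by (simp add: integral_unique)
  finally have 2: "\<bar>integral {1/2..R} (\<lambda>x. p' x * cos (w * x) / w\<^sup>2)\<bar> \<le> (2 * p s - p (1/2) - p R) / w\<^sup>2"
    by simp
  have sin0: "sin (w * (real j + 1/2)) = 0" for j :: nat
  proof -
    have "w * (real j + 1/2) = real (k * (2 * j + 1)) * pi" by (simp add: w_def algebra_simps)
    thus ?thesis by (simp only: sin_npi)
  qed
  have \<Phi>: "\<bar>\<Phi> (real j + 1/2)\<bar> \<le> p (real j + 1/2) / w\<^sup>2" for j :: nat
  proof -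
    have "p (real j + 1/2) \<ge> 0" by (simp add: p_def g_def)
    thus ?thesis
      unfolding \<Phi>_def sin0 using w by (auto simp: abs_mult intro!: divide_right_mono mult_left_le)
  qed
  \<comment> \<open>The end values of \<open>p\<close> from the boundary terms cancel those in the
    variation, leaving twice the peak value.\<close>
  have "\<bar>integral {1/2..R} (\<lambda>x. g x * cos (w * x))\<bar> \<le> p R / w\<^sup>2 + p (1/2) / w\<^sup>2 + (2 * p s - p (1/2) - p R) / w\<^sup>2"
    unfolding 1 using \<Phi>[of n, folded R_def] \<Phi>[of 0, simplified] 2 by linarith
  also have "\<dots> = 2 * p s / w\<^sup>2" by (simp add: add_divide_distrib diff_divide_distrib)
  also have "\<dots> = p s / (2 * pi\<^sup>2 * (real k)\<^sup>2)"
    by (simp add: w_def power_mult_distrib)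
  finally show ?thesis unfolding R_def w_def p_def g_def .
qed

text \<open>The Fourier coefficient over the full period [-1/2, 1/2], halved by evenness. The cosine
  series therefore carries an extra factor 2 for \<open>k > 0\<close>.\<close>

definition gauss_cos_coeff :: "real \<Rightarrow> nat \<Rightarrow> real" where
  "gauss_cos_coeff l k = 2 * integral {0..1/2} (\<lambda>x. exp (- (x\<^sup>2 / (2 * l\<^sup>2))) * cos (2 * pi * k * x))"

text \<open>The tail bound is uniform in the upper end \<open>n + 1/2\<close>, so letting
  \<open>n\<close> tend to infinity turns the other part into the Gaussian integral over the whole
  line. Doubling the tail changes \<open>2 * pi\<^sup>2\<close> into
  \<open>pi\<^sup>2\<close>.\<close>

lemma gauss_cos_coeff_le:
  fixes l :: real and k :: nat
  defines "s \<equiv> max l (1/2)"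
  assumes l: "l > 0" and k: "k > 0"
  shows "\<bar>gauss_cos_coeff l k\<bar> \<le> l * sqrt (2 * pi) * exp (- (2 * pi\<^sup>2 * l\<^sup>2 * (real k)\<^sup>2))
           + s / l\<^sup>2 * exp (- (s\<^sup>2 / (2 * l\<^sup>2))) / (pi\<^sup>2 * (real k)\<^sup>2)"
proof -
  let ?f = "\<lambda>x. exp (- (x\<^sup>2 / (2 * l\<^sup>2))) * cos (2 * pi * k * x)"
  define B where "B = s / l\<^sup>2 * exp (- (s\<^sup>2 / (2 * l\<^sup>2))) / (pi\<^sup>2 * (real k)\<^sup>2)"
  have "(\<lambda>n. \<bar>2 * integral {0..real n + 1/2} ?f\<bar> + B) \<longlonglongrightarrow>
      \<bar>l * sqrt (2 * pi) * exp (- ((l * (2 * pi * k))\<^sup>2 / 2))\<bar> + B"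
    by (intro tendsto_add tendsto_rabs gauss_half_line_limit l tendsto_const)
  moreover have "\<forall>\<^sub>F n in sequentially. \<bar>gauss_cos_coeff l k\<bar> \<le> \<bar>2 * integral {0..real n + 1/2} ?f\<bar> + B"
    using eventually_ge_at_top[of "nat \<lceil>s\<rceil>"]
  proof eventually_elim
    case (elim n)
    hence n: "real n + 1/2 \<ge> s" by linarith
    have "integral {0..real n + 1/2} ?f = integral {0..1/2} ?f + integral {1/2..real n + 1/2} ?f"
      using l by (intro Henstock_Kurzweil_Integration.integral_combine[symmetric] integrable_continuous_interval continuous_intros) auto
    moreover have "\<bar>integral {1/2..real n + 1/2} ?f\<bar> \<le> B / 2"
      using gauss_tail_cos_integral_le[OF l k n[unfolded s_def]] by (simp add: s_def B_def)
    ultimately have "\<bar>2 * integral {0..1/2} ?f\<bar> \<le> \<bar>2 * integral {0..real n + 1/2} ?f\<bar> + B"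
      by arith
    thus ?case by (simp only: gauss_cos_coeff_def)
  qed
  ultimately have "\<bar>gauss_cos_coeff l k\<bar> \<le> \<bar>l * sqrt (2 * pi) * exp (- ((l * (2 * pi * k))\<^sup>2 / 2))\<bar> + B"
    by (rule tendsto_lowerbound) simp
  thus ?thesis using l by (simp add: B_def abs_mult power_mult_distrib mult_ac)
qed

text \<open>The coefficient bound is summable: its Gaussian part is dominated by a geometric
  sequence since \<open>k \<le> k\<^sup>2\<close>, the rest is a multiple of
  \<open>1 / k\<^sup>2\<close>. Negative \<open>t\<close> follows by evenness.\<close>

lemma gauss_cos_series_sums:
  fixes l t :: real
  assumes l: "l > 0" and t: "\<bar>t\<bar> \<le> 1/2"
  shows "(\<lambda>k. (if k = 0 then 1 else 2) * gauss_cos_coeff l k * cos (2 * pi * real k * t))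
           sums exp (- (t\<^sup>2 / (2 * l\<^sup>2)))"
proof -
  let ?b = "\<lambda>k. (if k = 0 then 1 else 2) * gauss_cos_coeff l k"
  define a where "a = 2 * pi\<^sup>2 * l\<^sup>2"
  define B where "B = max l (1/2) / l\<^sup>2 * exp (- ((max l (1/2))\<^sup>2 / (2 * l\<^sup>2))) / pi\<^sup>2"
  have a: "a > 0" using l by (simp add: a_def)
  have "summable (\<lambda>k. \<bar>?b k\<bar>)"
  proof (rule summable_comparison_test')
    show "summable (\<lambda>k. 2 * (l * sqrt (2 * pi) * exp (- a) ^ k + B * (1 / real k ^ 2)))"
      using a by (intro summable_mult summable_add summable_geometric inverse_power_summable[unfolded inverse_eq_divide]) auto
    fix k :: nat assume k: "k \<ge> 1"
    have "real k \<le> (real k)\<^sup>2" using k by (simp add: power2_eq_square)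
    hence "exp (- (a * (real k)\<^sup>2)) \<le> exp (- (real k * a))" using a by simp
    also have "\<dots> = exp (- a) ^ k" by (simp add: exp_of_nat_mult[symmetric])
    finally have "l * sqrt (2 * pi) * exp (- (a * (real k)\<^sup>2)) \<le> l * sqrt (2 * pi) * exp (- a) ^ k"
      using l by (intro mult_left_mono) auto
    moreover have "\<bar>gauss_cos_coeff l k\<bar> \<le> l * sqrt (2 * pi) * exp (- (a * (real k)\<^sup>2)) + B * (1 / real k ^ 2)"
      using gauss_cos_coeff_le[OF l, of k] k by (simp add: a_def B_def)
    ultimately have "\<bar>gauss_cos_coeff l k\<bar> \<le> l * sqrt (2 * pi) * exp (- a) ^ k + B * (1 / real k ^ 2)"
      by linarith
    thus "norm \<bar>?b k\<bar> \<le> 2 * (l * sqrt (2 * pi) * exp (- a) ^ k + B * (1 / real k ^ 2))"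
      using k by (simp add: abs_mult)
  qed
  hence *: "(\<lambda>k. ?b k * cos (2 * pi * real k * u)) sums exp (- (u\<^sup>2 / (2 * l\<^sup>2)))" if "u \<in> {0..1/2}" for u
    using l that by (intro cosine_series_sums) (auto simp: gauss_cos_coeff_def intro!: continuous_intros)
  have "cos (2 * pi * real k * \<bar>t\<bar>) = cos (2 * pi * real k * t)" for k
    by (cases "t \<ge> 0") auto
  thus ?thesis using *[of "\<bar>t\<bar>"] t by simp
qed

section \<open>Tail sums of the coefficients and the one-dimensional interpolation error\<close>

lemma sum_le_telescope:
  fixes f F :: "nat \<Rightarrow> real"
  assumes "\<And>k. k \<ge> m \<Longrightarrow> f (Suc k) \<le> F k - F (Suc k)" and "m \<le> n"
  shows "sum f {m<..n} \<le> F m - F n"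
  using assms(2)
proof (induction n rule: dec_induct)
  case (step n)
  have "{m<..Suc n} = insert (Suc n) {m<..n}" using step by auto
  thus ?case using step assms(1)[of n] by simp
qed simp

text \<open>Discrete analogue of the Gaussian tail estimate. The comparison sequence keeps the
  denominator \<open>2 * a * m\<close> fixed, so telescoping reduces to
  \<open>1 + 2 * a * m \<le> exp (a * (2 * k + 1))\<close>.\<close>

lemma sum_exp_neg_square_le:
  fixes a :: real
  assumes a: "a > 0" and m: "m > 0" "m \<le> n"
  shows "(\<Sum>k\<in>{m<..n}. exp (- (a * (real k)\<^sup>2))) \<le> exp (- (a * (real m)\<^sup>2)) / (2 * a * m)"
proof -
  have "(\<Sum>k\<in>{m<..n}. exp (- (a * (real k)\<^sup>2)))
      \<le> exp (- (a * (real m)\<^sup>2)) / (2 * a * m) - exp (- (a * (real n)\<^sup>2)) / (2 * a * m)"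
  proof (rule sum_le_telescope[OF _ m(2)])
    fix k assume k: "k \<ge> m"
    have "a * (2 * m) \<le> a * (2 * real k + 1)"
      using a k by (intro mult_left_mono) auto
    hence "1 + 2 * a * m \<le> 1 + a * (2 * real k + 1)"
      by (simp only: mult_ac add_left_mono)
    also have "\<dots> \<le> exp (a * (2 * real k + 1))" by simp
    finally have "exp (- (a * (real (Suc k))\<^sup>2)) * (1 + 2 * a * m)
        \<le> exp (- (a * (real (Suc k))\<^sup>2)) * exp (a * (2 * real k + 1))"
      by (intro mult_left_mono) auto
    also have "\<dots> = exp (- (a * (real k)\<^sup>2))"
      by (simp add: power2_eq_square algebra_simps flip: exp_add)
    finally show "exp (- (a * (real (Suc k))\<^sup>2))
       \<le> exp (- (a * (real k)\<^sup>2)) / (2 * a * m) - exp (- (a * (real (Suc k))\<^sup>2)) / (2 * a * m)"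
      using a m by (simp add: field_simps)
  qed
  also have "\<dots> \<le> exp (- (a * (real m)\<^sup>2)) / (2 * a * m)" using a by simp
  finally show ?thesis .
qed

lemma sum_inverse_square_le:
  assumes "m > 0" "m \<le> n"
  shows "(\<Sum>k\<in>{m<..n}. 1 / (real k)\<^sup>2) \<le> 1 / m"
proof -
  have "(\<Sum>k\<in>{m<..n}. 1 / (real k)\<^sup>2) \<le> 1 / m - 1 / n"
  proof (rule sum_le_telescope[OF _ assms(2)])
    fix k assume "k \<ge> m"
    hence "real k > 0" using assms by simp
    have "1 / (real (Suc k))\<^sup>2 \<le> 1 / (real k * real (Suc k))"
      unfolding power2_eq_square using \<open>real k > 0\<close> by (intro frac_le mult_right_mono) auto
    also have "\<dots> = 1 / real k - 1 / real (Suc k)"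
      using \<open>real k > 0\<close> by (simp add: field_simps)
    finally show "1 / (real (Suc k))\<^sup>2 \<le> 1 / real k - 1 / real (Suc k)" .
  qed
  also have "\<dots> \<le> 1 / m" by simp
  finally show ?thesis .
qed

text \<open>\<open>gauss_gamma\<close> is the coefficient bound at \<open>k = M\<close>, and
  \<open>gauss_A\<close> bounds the sum of the coefficient bounds over \<open>k > M\<close>. The
  series weight 2 for positive frequencies and the aliasing factors 1 and 2 give the constants 2 and
  4.\<close>

lemma gauss_interp_error_le:
  fixes l \<eta> x :: real and M :: nat
  assumes l: "l > 0" and M: "M > 0" and \<eta>: "\<eta> = l * pi * real (2 * M) / sqrt 2" and x: "\<bar>x\<bar> \<le> 1/2"
  shows "cmod (exp (- (x\<^sup>2 / (2 * l\<^sup>2))) - trig_interp M (\<lambda>t. exp (- (t\<^sup>2 / (2 * l\<^sup>2)))) x)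
           \<le> 2 * gauss_gamma \<eta> l + 4 * gauss_A \<eta> l"
proof -
  define a where "a = 2 * pi\<^sup>2 * l\<^sup>2"
  \<comment> \<open>The constant in front of \<open>1 / k\<^sup>2\<close> in the coefficient bound,
    with \<open>max l (1/2)\<close> resolved by cases.\<close>
  define E where "E = (if l < 1/2 then exp (- (1 / (8 * l\<^sup>2))) / (2 * l\<^sup>2) else exp (- (1/2)) / l) / pi\<^sup>2"
  have a: "a > 0" using l by (simp add: a_def)
  have E: "E \<ge> 0" using l by (simp add: E_def)
  have \<eta>': "\<eta> = sqrt 2 * l * pi * M" by (simp add: \<eta> real_div_sqrt field_simps)
  have \<eta>2: "\<eta>\<^sup>2 = a * (real M)\<^sup>2" by (simp add: \<eta>' a_def power_mult_distrib)
  have "max l (1/2) / l\<^sup>2 * exp (- ((max l (1/2))\<^sup>2 / (2 * l\<^sup>2))) / pi\<^sup>2 = E"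
  proof (cases "l < 1/2")
    case False
    hence "max l (1/2) = l" by simp
    thus ?thesis using l False by (simp add: E_def power2_eq_square)
  qed (simp add: E_def power2_eq_square)
  hence c: "\<bar>gauss_cos_coeff l k\<bar> \<le> l * sqrt (2 * pi) * exp (- (a * (real k)\<^sup>2)) + E * (1 / (real k)\<^sup>2)" if "k > 0" for k
    using gauss_cos_coeff_le[OF l that] by (simp add: a_def flip: divide_divide_eq_left)
  have gamma: "l * sqrt (2 * pi) * exp (- (a * (real M)\<^sup>2)) + E * (1 / (real M)\<^sup>2) = gauss_gamma \<eta> l"
    unfolding gauss_gamma_def \<eta>2 using l M by (auto simp: E_def a_def field_simps power2_eq_square)
  have A1: "l * sqrt (2 * pi) * (exp (- (a * (real M)\<^sup>2)) / (2 * a * M)) = 1 / (2 * \<eta> * sqrt pi) * exp (- \<eta>\<^sup>2)"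
  proof -
    have "l * sqrt (2 * pi) / (2 * a * M) = 1 / (2 * \<eta> * sqrt pi)"
      using l M by (simp add: a_def \<eta>' field_simps power2_eq_square real_sqrt_mult)
    hence "l * sqrt (2 * pi) / (2 * a * M) * exp (- \<eta>\<^sup>2) = 1 / (2 * \<eta> * sqrt pi) * exp (- \<eta>\<^sup>2)"
      by (rule arg_cong)
    thus ?thesis unfolding \<eta>2 by (simp only: times_divide_eq_right times_divide_eq_left)
  qed
  have A2: "E * (1 / M) = (if l < 1/2 then exp (- (1 / (8 * l\<^sup>2))) / (sqrt 2 * l * pi * \<eta>)
      else sqrt 2 * exp (- (1/2)) / (pi * \<eta>))"
    using l M by (auto simp: E_def \<eta>' field_simps power2_eq_square)
  show ?thesis
  proof (rule trig_interp_error_le[OF gauss_cos_series_sums[OF l] M _ x])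
    fix N assume N: "N \<ge> M"
    let ?b = "\<lambda>k. (if k = 0 then 1 else 2) * gauss_cos_coeff l k"
    have "(\<Sum>k\<in>{M<..N}. \<bar>?b k\<bar>) \<le> (\<Sum>k\<in>{M<..N}. 2 * (l * sqrt (2 * pi) * exp (- (a * (real k)\<^sup>2)) + E * (1 / (real k)\<^sup>2)))"
    proof (rule sum_mono)
      fix k assume "k \<in> {M<..N}"
      hence "k > 0" by simp
      from mult_left_mono[OF c[OF this], of 2] this
      show "\<bar>?b k\<bar> \<le> 2 * (l * sqrt (2 * pi) * exp (- (a * (real k)\<^sup>2)) + E * (1 / (real k)\<^sup>2))"
        by (simp add: abs_mult)
    qed
    also have "\<dots> = 2 * (l * sqrt (2 * pi) * (\<Sum>k\<in>{M<..N}. exp (- (a * (real k)\<^sup>2))) + E * (\<Sum>k\<in>{M<..N}. 1 / (real k)\<^sup>2))"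
      by (simp only: sum_distrib_left[symmetric] sum.distrib)
    also have "\<dots> \<le> 2 * (l * sqrt (2 * pi) * (exp (- (a * (real M)\<^sup>2)) / (2 * a * M)) + E * (1 / M))"
      using l E by (intro mult_left_mono add_mono sum_exp_neg_square_le sum_inverse_square_le a M N) auto
    also have "\<dots> = 2 * gauss_A \<eta> l"
      unfolding A1 A2 gauss_A_def ..
    finally have "(\<Sum>k\<in>{M<..N}. \<bar>?b k\<bar>) \<le> 2 * gauss_A \<eta> l" .
    moreover have "\<bar>?b M\<bar> \<le> 2 * gauss_gamma \<eta> l"
      using c[OF M] M unfolding gamma by (simp add: abs_mult)
    ultimately show "\<bar>?b M\<bar> + 2 * (\<Sum>k\<in>{M<..N}. \<bar>?b k\<bar>) \<le> 2 * gauss_gamma \<eta> l + 4 * gauss_A \<eta> l"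
      by simp
  qed
qed

subsection \<open>Tensor product structure\<close>

lemma gauss_kernel_eq_prod: "gauss_kernel l r = (\<Prod>i\<in>UNIV. exp (- ((r $ i)\<^sup>2 / (2 * l\<^sup>2))))"
  by (simp add: gauss_kernel_def norm_vec_def L2_set_def sum_nonneg sum_divide_distrib sum_negf flip: exp_sum)

text \<open>Distributivity over a finite product, with vectors in place of choice functions; it
  factors both the sum over nodes and the sum over frequencies.\<close>

lemma sum_prod_vec:
  fixes f :: "'n::finite \<Rightarrow> 'a \<Rightarrow> 'b::comm_semiring_1"
  assumes "finite J"
  shows "(\<Sum>k | \<forall>i. k $ i \<in> J. \<Prod>i\<in>UNIV. f i (k $ i)) = (\<Prod>i\<in>UNIV. \<Sum>j\<in>J. f i j)"
proof -
  have "(\<Prod>i\<in>UNIV. \<Sum>j\<in>J. f i j) = (\<Sum>h\<in>UNIV \<rightarrow>\<^sub>E J. \<Prod>i\<in>UNIV. f i (h i))"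
    using assms by (intro prod_sum_PiE) auto
  also have "\<dots> = (\<Sum>k | \<forall>i. k $ i \<in> J. \<Prod>i\<in>UNIV. f i (k $ i))"
    by (rule sum.reindex_bij_witness[of _ vec_nth vec_lambda]) auto
  finally show ?thesis ..
qed

lemma freq_set_even: "freq_set (2 * M) = {k. \<forall>i. k $ i \<in> {- int M..<int M}}"
proof -
  have "- (real (2 * M) / 2) \<le> of_int j \<and> of_int j < real (2 * M) / 2 \<longleftrightarrow> j \<in> {- int M..<int M}" for j
    by auto
  thus ?thesis by (simp only: freq_set_def)
qed

text \<open>Kernel and exponentials are products over the coordinates, so first the coefficients and
  then the trigonometric polynomial factor. All nodes lie in the cube, where the periodic
  continuation agrees with the kernel.\<close>

lemma fourier_approx_gauss_eq_prod:
  assumes M: "M > 0"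
  shows "fourier_approx (periodic_cont (gauss_kernel l)) (2 * M) r
       = (\<Prod>i\<in>UNIV. trig_interp M (\<lambda>t. exp (- (t\<^sup>2 / (2 * l\<^sup>2)))) (r $ i))"
proof -
  let ?J = "{- int M..<int M}" and ?g = "\<lambda>t. exp (- (t\<^sup>2 / (2 * l\<^sup>2)))"
  define c where "c k = (\<Sum>j\<in>?J. complex_of_real (?g (j / real (2 * M))) * cis (- 2 * pi * j * k / real (2 * M))) / of_nat (2 * M)" for k :: int
  have kernel: "periodic_cont (gauss_kernel l) (\<chi> i. of_int (j $ i) / real (2 * M)) = (\<Prod>i\<in>UNIV. ?g (j $ i / real (2 * M)))"
    if "j \<in> freq_set (2 * M)" for j
  proof -
    have "(\<chi> i. of_int (j $ i) / real (2 * M)) \<in> cube"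
      using that M by (auto simp: freq_set_def cube_def field_simps intro: less_imp_le)
    thus ?thesis by (simp add: periodic_cont_gauss_on_cube gauss_kernel_eq_prod)
  qed
  have char_neg: "exp (- 2 * of_real pi * \<i> * of_int (\<Sum>i\<in>UNIV. j $ i * k $ i) / of_nat (2 * M))
      = (\<Prod>i\<in>UNIV. cis (- 2 * pi * of_int (j $ i) * of_int (k $ i) / real (2 * M)))" for j k :: "int ^ 3"
    by (simp add: cis_conv_exp sum_distrib_left sum_distrib_right sum_divide_distrib mult_ac flip: exp_sum)
  have char_pos: "exp (2 * of_real pi * \<i> * of_real (\<Sum>i\<in>UNIV. of_int (k $ i) * r $ i))
      = (\<Prod>i\<in>UNIV. cis (2 * pi * of_int (k $ i) * r $ i))" for k :: "int ^ 3"
    by (simp add: cis_conv_exp sum_distrib_left mult_ac flip: exp_sum)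
  have coeff: "dft_coeff (periodic_cont (gauss_kernel l)) (2 * M) k = (\<Prod>i\<in>UNIV. c (k $ i))" for k
  proof -
    have "dft_coeff (periodic_cont (gauss_kernel l)) (2 * M) k = 1 / of_nat (2 * M) ^ 3 *
        (\<Sum>j\<in>freq_set (2 * M). \<Prod>i\<in>UNIV. complex_of_real (?g (j $ i / real (2 * M))) * 
           cis (- 2 * pi * of_int (j $ i) * of_int (k $ i) / real (2 * M)))"
      unfolding dft_coeff_def char_neg by (simp only: kernel of_real_prod prod.distrib cong: sum.cong)
    also have "\<dots> = (\<Prod>i\<in>UNIV. c (k $ i))"
      unfolding freq_set_even c_def prod_dividef
      by (subst sum_prod_vec[OF finite_atLeastLessThan_int, where f = "\<lambda>i j. complex_of_real (?g (j / real (2 * M))) * 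
            cis (- 2 * pi * of_int j * of_int (k $ i) / real (2 * M))"]) simp
    finally show ?thesis .
  qed
  show ?thesis
    unfolding fourier_approx_def coeff char_pos prod.distrib[symmetric] freq_set_even trig_interp_def c_def
    by (rule sum_prod_vec[OF finite_atLeastLessThan_int, where f = "\<lambda>i k. (\<Sum>j\<in>?J. complex_of_real (?g (j / real (2 * M))) * 
          cis (- 2 * pi * of_int j * of_int k / real (2 * M))) / of_nat (2 * M) * cis (2 * pi * of_int k * r $ i)"])
qed

text \<open>Factors are exchanged one at a time: an exchange costs \<open>e\<close>, the factors
  \<open>G i\<close> have norm at most 1 and the factors \<open>F i\<close> at most
  \<open>1 + e\<close>.\<close>

lemma norm_prod_diff_le:
  fixes G F :: "'a \<Rightarrow> 'b::{real_normed_field}"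
  assumes "finite I" and G: "\<And>i. i \<in> I \<Longrightarrow> norm (G i) \<le> 1" and e: "\<And>i. i \<in> I \<Longrightarrow> norm (G i - F i) \<le> e"
  shows "norm (prod G I - prod F I) \<le> (1 + e) ^ card I - 1"
  using assms
proof (induction I)
  case (insert a I)
  have F: "norm (F i) \<le> 1 + e" if "i \<in> insert a I" for i
    using norm_triangle_ineq4[of "G i" "G i - F i"] insert.prems(1,2)[OF that] by simp
  have "norm (prod F I) \<le> (\<Prod>i\<in>I. 1 + e)"
    unfolding prod_norm[symmetric] using F by (intro prod_mono) auto
  hence PF: "norm (prod F I) \<le> (1 + e) ^ card I" by simp
  have e0: "e \<ge> 0" using insert.prems(2)[of a] norm_ge_zero order_trans by blast
  have "prod G (insert a I) - prod F (insert a I) = G a * (prod G I - prod F I) + (G a - F a) * prod F I"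
    using insert.hyps by (simp add: algebra_simps)
  also have "norm \<dots> \<le> norm (G a) * norm (prod G I - prod F I) + norm (G a - F a) * norm (prod F I)"
    by (metis norm_mult norm_triangle_ineq)
  also have "\<dots> \<le> 1 * ((1 + e) ^ card I - 1) + e * (1 + e) ^ card I"
    using insert.prems e0 by (intro add_mono mult_mono insert.IH PF) auto
  finally show ?case using insert.hyps by (simp add: algebra_simps)
qed simp

subsection \<open>Numerical bounds\<close>

text \<open>The left side is maximal at \<open>y = 1\<close>. Instead of calculus,
  \<open>y \<le> (1 + y\<^sup>2) / 2\<close> is combined with
  \<open>1 + x \<le> exp x\<close>.\<close>

lemma mult_exp_neg_half_square_le:
  fixes y :: real
  shows "y * exp (- (y\<^sup>2 / 2)) \<le> exp (- (1/2))"
proof -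
  have "1 + (y\<^sup>2 - 1) / 2 - y = (y - 1)\<^sup>2 / 2"
    by (simp add: power2_eq_square field_simps)
  also have "\<dots> \<ge> 0" by simp
  finally have "y \<le> 1 + (y\<^sup>2 - 1) / 2" by (simp only: diff_ge_0_iff_ge)
  also have "\<dots> \<le> exp ((y\<^sup>2 - 1) / 2)" by (rule exp_ge_add_one_self)
  finally have "y * exp (- (y\<^sup>2 / 2)) \<le> exp ((y\<^sup>2 - 1) / 2) * exp (- (y\<^sup>2 / 2))"
    by (intro mult_right_mono) auto
  also have "\<dots> = exp (- (1/2))" by (simp add: diff_divide_distrib flip: exp_add)
  finally show ?thesis .
qed

lemma exp_neg_half_le: "exp (- (1/2)) \<le> (8/13 :: real)"
proof -
  \<comment> \<open>13/8 is the quadratic Taylor polynomial 1 + 1/2 + 1/8.\<close>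
  have "13/8 \<le> exp (1/2 :: real)"
    using exp_lower_Taylor_quadratic[of "1/2 :: real"] by (simp add: power2_eq_square)
  thus ?thesis by (simp add: exp_minus field_simps)
qed

text \<open>Since \<open>M\<close> is at least 1, \<open>l\<close> is at most
  \<open>\<eta> / (sqrt 2 * pi)\<close>, and \<open>\<eta> \<ge> 1\<close> controls the rest. The
  summands are at most 0.22 and 0.62 for \<open>gauss_gamma\<close>, 0.11 and 0.28 for
  \<open>gauss_A\<close>.\<close>

lemma gauss_gamma_A_bounds:
  assumes l: "l > 0" and M: "M > 0" and \<eta>: "\<eta> = l * pi * real (2 * M) / sqrt 2" and \<eta>1: "\<eta> \<ge> 1"
  shows "0 \<le> gauss_gamma \<eta> l" "gauss_gamma \<eta> l \<le> 9/10" "0 \<le> gauss_A \<eta> l" "gauss_A \<eta> l \<le> 2/5"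
proof -
  let ?h = "exp (- (1/2)) :: real"
  have \<eta>': "\<eta> = sqrt 2 * l * pi * M" by (simp add: \<eta> real_div_sqrt field_simps)
  have sqrt2: "sqrt 2 \<le> 1415/1000" by (rule real_le_lsqrt) (simp_all add: power2_eq_square)
  have pi: "pi \<ge> 314/100" using pi_approx by simp
  have sqrtpi: "sqrt pi \<ge> 177/100" by (rule real_le_rsqrt) (use pi in \<open>simp add: power2_eq_square\<close>)
  have l_le: "l \<le> \<eta> / (sqrt 2 * pi)" using l M by (simp add: \<eta>' field_simps)
  have \<eta>sq: "\<eta> \<le> \<eta>\<^sup>2" using \<eta>1 by (simp add: power2_eq_square)
  have hh: "exp (-1 :: real) \<le> 64/169"
  proof -
    have "exp (-1 :: real) = ?h * ?h" by (simp flip: exp_add)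
    also have "\<dots> \<le> 8/13 * (8/13)" by (intro mult_mono exp_neg_half_le) auto
    finally show ?thesis by simp
  qed
  have exp1: "exp (- \<eta>\<^sup>2) \<le> 64/169" using \<eta>sq \<eta>1 by (intro order_trans[OF _ hh]) simp
  have \<eta>exp: "\<eta> * exp (- \<eta>\<^sup>2) \<le> 64/169"
  proof -
    have "\<eta> \<le> exp (\<eta>\<^sup>2 - 1)" using exp_ge_add_one_self[of "\<eta>\<^sup>2 - 1"] \<eta>sq by linarith
    hence "\<eta> * exp (- \<eta>\<^sup>2) \<le> exp (\<eta>\<^sup>2 - 1) * exp (- \<eta>\<^sup>2)" by (intro mult_right_mono) auto
    also have "\<dots> = exp (-1)" by (simp flip: exp_add)
    finally show ?thesis using hh by simp
  qed
  have q: "sqrt 2 * ?h / pi \<le> 28/100"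
  proof -
    have "sqrt 2 * ?h \<le> 1415/1000 * (8/13)" by (intro mult_mono sqrt2 exp_neg_half_le) auto
    also have "\<dots> \<le> 28/100 * pi" using pi by simp
    finally show ?thesis by (simp add: field_simps)
  qed
  have q_div: "sqrt 2 * ?h / (pi * \<eta>) \<le> 28/100"
  proof -
    have "sqrt 2 * ?h / (pi * \<eta>) \<le> sqrt 2 * ?h / (pi * 1)"
      using \<eta>1 by (intro divide_left_mono mult_left_mono) auto
    thus ?thesis using q unfolding mult_1_right by linarith
  qed
  \<comment> \<open>With \<open>y = 1 / (2 * l)\<close> the exponent is
    \<open>- (y\<^sup>2 / 2)\<close>, which removes the singularity at small
    \<open>l\<close>.\<close>
  have small_l: "exp (- (1 / (8 * l\<^sup>2))) / l \<le> 2 * ?h"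
    using mult_exp_neg_half_square_le[of "1 / (2 * l)"] l by (simp add: power_divide power_mult_distrib field_simps)
  have g1: "l * sqrt (2 * pi) * exp (- \<eta>\<^sup>2) \<le> 22/100"
  proof -
    have "l * sqrt (2 * pi) * exp (- \<eta>\<^sup>2) \<le> \<eta> / (sqrt 2 * pi) * sqrt (2 * pi) * exp (- \<eta>\<^sup>2)"
      by (intro mult_right_mono l_le) auto
    also have "\<dots> = \<eta> * exp (- \<eta>\<^sup>2) / sqrt pi"
      by (simp add: real_sqrt_mult field_simps)
    also have "\<dots> \<le> (64/169) / (177/100)"
      by (intro frac_le \<eta>exp sqrtpi) auto
    finally show ?thesis by simp
  qed
  have g2: "(if l < 1/2 then exp (- (1 / (8 * l\<^sup>2))) / \<eta>\<^sup>2 else 2 * l * ?h / \<eta>\<^sup>2) \<le> 62/100"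
  proof (cases "l < 1/2")
    case True
    hence "l\<^sup>2 \<le> (1/2)\<^sup>2" using l by (intro power_mono) auto
    hence "1/2 \<le> 1 / (8 * l\<^sup>2)" using l by (simp add: field_simps power2_eq_square)
    hence "exp (- (1 / (8 * l\<^sup>2))) \<le> 8/13" by (intro order_trans[OF _ exp_neg_half_le]) simp
    hence "exp (- (1 / (8 * l\<^sup>2))) / \<eta>\<^sup>2 \<le> (8/13) / 1"
      using \<eta>sq \<eta>1 by (intro frac_le) auto
    thus ?thesis using True by simp
  next
    case False
    have "2 * l * ?h / \<eta>\<^sup>2 \<le> 2 * (\<eta> / (sqrt 2 * pi)) * ?h / \<eta>\<^sup>2"
      by (intro divide_right_mono mult_right_mono mult_left_mono l_le) auto
    also have "\<dots> = sqrt 2 * ?h / (pi * \<eta>)" using \<eta>1 by (simp add: field_simps power2_eq_square)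
    finally show ?thesis using q_div False by simp
  qed
  have A1: "1 / (2 * \<eta> * sqrt pi) * exp (- \<eta>\<^sup>2) \<le> 11/100"
  proof -
    have "1 / (2 * \<eta> * sqrt pi) * exp (- \<eta>\<^sup>2) \<le> 1 / (2 * 1 * (177/100)) * (64/169)"
      using \<eta>1 by (intro mult_mono frac_le mult_left_mono sqrtpi exp1) auto
    thus ?thesis by simp
  qed
  have A2: "(if l < 1/2 then exp (- (1 / (8 * l\<^sup>2))) / (sqrt 2 * l * pi * \<eta>) else sqrt 2 * ?h / (pi * \<eta>)) \<le> 28/100"
  proof (cases "l < 1/2")
    case True
    have "exp (- (1 / (8 * l\<^sup>2))) / (sqrt 2 * l * pi * \<eta>) = (exp (- (1 / (8 * l\<^sup>2))) / l) / (sqrt 2 * pi * \<eta>)"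
      by simp
    also have "\<dots> \<le> (2 * ?h) / (sqrt 2 * pi * \<eta>)"
      using \<eta>1 by (intro divide_right_mono small_l) auto
    also have "\<dots> = sqrt 2 * ?h / (pi * \<eta>)" using \<eta>1 by (simp add: field_simps)
    finally have "exp (- (1 / (8 * l\<^sup>2))) / (sqrt 2 * l * pi * \<eta>) \<le> 28/100"
      using q_div by (rule order_trans)
    thus ?thesis by (simp only: True if_True)
  qed (use q_div in simp)
  show "gauss_gamma \<eta> l \<le> 9/10" using g1 g2 unfolding gauss_gamma_def by linarith
  show "gauss_A \<eta> l \<le> 2/5" using A1 A2 unfolding gauss_A_def by linarith
  show "0 \<le> gauss_gamma \<eta> l" "0 \<le> gauss_A \<eta> l"
    using l \<eta>1 by (auto simp: gauss_gamma_def gauss_A_def intro!: add_nonneg_nonneg)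
qed

text \<open>The difference of the two sides is \<open>A\<close> times a bracket that may be negative
  plus a nonnegative term in \<open>g\<close>; the latter compensates on the given range.\<close>

lemma cube_error_le:
  fixes A g :: real
  assumes A: "0 \<le> A" "A \<le> 2/5" and g: "0 \<le> g" "g \<le> 9/10"
  defines "e \<equiv> 2 * g + 4 * A"
  shows "(1 + e) ^ 3 - 1 \<le> 15 * g * (g + 5/2) + 102 * A"
proof -
  have g2: "0 \<le> g\<^sup>2" "g\<^sup>2 \<le> 81/100" using power_mono[OF g(2,1), of 2] by (simp_all add: power2_eq_square)
  have "15 * g * (g + 5/2) + 102 * A - ((1 + e) ^ 3 - 1)
      = A * (90 - 48 * A - 64 * A\<^sup>2 - 48 * g - 96 * A * g - 48 * g\<^sup>2) + g * (63/2 + 3 * g - 8 * g\<^sup>2)"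
    by (simp add: e_def power2_eq_square power3_eq_cube algebra_simps)
  also have "\<dots> \<ge> 0"
  proof -
    \<comment> \<open>\<open>L\<close> is the bracket with \<open>A = 2/5\<close> put into every
      subtracted term; it is negative for \<open>g\<close> near 9/10.\<close>
    define L where "L = 6056/100 - 864/10 * g - 48 * g\<^sup>2"
    have "A\<^sup>2 \<le> (2/5)\<^sup>2" "A * g \<le> 2/5 * g"
      by (rule power_mono[OF A(2,1)], rule mult_right_mono[OF A(2) g(1)])
    hence "L \<le> 90 - 48 * A - 64 * A\<^sup>2 - 48 * g - 96 * A * g - 48 * g\<^sup>2"
      using A g by (simp add: L_def power2_eq_square)
    hence "A * L \<le> A * (90 - 48 * A - 64 * A\<^sup>2 - 48 * g - 96 * A * g - 48 * g\<^sup>2)"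
      using A by (intro mult_left_mono)
    \<comment> \<open>For fixed \<open>L\<close>, the product is linear in \<open>A\<close> on
      [0, 2/5] and so minimal at an end point.\<close>
    moreover have "min 0 (2/5 * L) \<le> A * L"
      using A by (cases "L \<ge> 0") (auto simp: min_def intro: mult_right_mono_neg)
    moreover have "0 \<le> g * (63/2 + 3 * g - 8 * g\<^sup>2)"
      using g g2 by (intro mult_nonneg_nonneg) auto
    moreover have "0 \<le> 2/5 * L + g * (63/2 + 3 * g - 8 * g\<^sup>2)"
    proof -
      have "g * g\<^sup>2 \<le> 9/10 * (81/100)" using g g2 by (intro mult_mono) auto
      moreover have "2/5 * L + g * (63/2 + 3 * g - 8 * g\<^sup>2)
          = 24224/1000 - 306/100 * g - 162/10 * g\<^sup>2 - 8 * (g * g\<^sup>2)"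
        by (simp add: L_def power2_eq_square algebra_simps)
      ultimately show ?thesis using g g2 by linarith
    qed
    ultimately show ?thesis by linarith
  qed
  finally show ?thesis by simp
qed

section \<open>Assembly of the three-dimensional error bound\<close>

theorem theorem3p2:
  fixes l \<eta> :: real and m :: nat
  assumes "l > 0"
    and "m > 0"
    and "even m"
    and "\<eta> = l * pi * real m / sqrt 2"
    and "\<eta> \<ge> 1"
  shows "sup_norm_cube (fourier_error (periodic_cont (gauss_kernel l)) m)
           \<le> 15 * gauss_gamma \<eta> l * (gauss_gamma \<eta> l + 5/2) + 102 * gauss_A \<eta> l"
proof -
  obtain M where m: "m = 2 * M" using assms(3) by auto
  have M: "M > 0" using assms(2) m by simp
  note \<eta> = assms(4)[unfolded m]
  define e where "e = 2 * gauss_gamma \<eta> l + 4 * gauss_A \<eta> l"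
  have "cmod (fourier_error (periodic_cont (gauss_kernel l)) m r) \<le> (1 + e) ^ 3 - 1" if r: "r \<in> cube" for r
  proof -
    let ?G = "\<lambda>i. complex_of_real (exp (- ((r $ i)\<^sup>2 / (2 * l\<^sup>2))))"
    let ?F = "\<lambda>i. trig_interp M (\<lambda>t. exp (- (t\<^sup>2 / (2 * l\<^sup>2)))) (r $ i)"
    have "- (1/2) \<le> r $ i \<and> r $ i \<le> 1/2" for i using r by (simp add: cube_def)
    hence "\<bar>r $ i\<bar> \<le> 1/2" for i by (simp only: abs_le_iff minus_le_iff[of "r $ i"])
    hence e: "cmod (?G i - ?F i) \<le> e" for i
      unfolding e_def by (rule gauss_interp_error_le[OF assms(1) M \<eta>])
    have G: "cmod (?G i) \<le> 1" for i by simp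
    have "fourier_error (periodic_cont (gauss_kernel l)) m r = (\<Prod>i\<in>UNIV. ?G i) - (\<Prod>i\<in>UNIV. ?F i)"
      unfolding fourier_error_def periodic_cont_gauss_on_cube[OF r] m fourier_approx_gauss_eq_prod[OF M] gauss_kernel_eq_prod
      by simp
    also have "cmod \<dots> \<le> (1 + e) ^ 3 - 1"
      using norm_prod_diff_le[of UNIV ?G ?F e] G e by simp
    finally show ?thesis .
  qed
  hence "sup_norm_cube (fourier_error (periodic_cont (gauss_kernel l)) m) \<le> (1 + e) ^ 3 - 1"
    \<comment> \<open>The origin witnesses that the cube is nonempty, as the supremum rule
      requires.\<close>
    unfolding sup_norm_cube_def by (intro cSUP_least) (auto simp: cube_def intro!: exI[of _ 0])
  also have "\<dots> \<le> 15 * gauss_gamma \<eta> l * (gauss_gamma \<eta> l + 5/2) + 102 * gauss_A \<eta> l"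
    unfolding e_def by (intro cube_error_le gauss_gamma_A_bounds[OF assms(1) M \<eta> assms(5)])
  finally show ?thesis .
qed

end
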